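(* There is no universal constant $c>0$ such that the LP-based independent rounding algorithm satisfies $\mathbb E[\mathrm{Rev}^{\mathrm{LP}}]\ge c\,\mathrm{OPT}_{\mathrm{on}}$ for all instances of the online allocation model in the full-compatibility setting.
   Context: Model. An instance consists of products $\mathcal I=\{1,\dots,m\}$, capacities $b_i\in\mathbb Z_+$, base rewards $r_i\ge 0$, bonus functions $f_i:\mathbb Z_+\to\mathbb R_+$ that are nonnegative and nondecreasing with $f_i(0)=0$, a horizon of $T$ periods and arrival probabilities $p_1,\dots,p_T\in[0,1]$. In period $t$ a customer arrives with probability $p_t$, independently across periods; $L$ is the total number of arrivals and $\mu_L=\sum_{t=1}^T p_t$ its mean. Each arriving customer must be immediately and irrevocably assigned to a product with remaining capacity or rejected; every customer may be assigned to every product (full compatibility). The $k$-th sale of product $i$ yields reward $r_i+f_i(k)$. An online algorithm $\pi$ knows all parameters of the instance, but its decision in each period depends only on the arrivals observed so far, its past decisions and internal randomization independent of the arrivals. $\mathrm{Rev}^\pi$ is its random total reward and $\mathrm{OPT}_{\mathrm{on}}=\sup_\pi\mathbb E[\mathrm{Rev}^\pi]$ over all online algorithms. LP relaxation: maximize $\sum_{i\in\mathcal I}\sum_{k=1}^{b_i}(r_i+f_i(k))\,y_{i,k}$ subject to $\sum_{i\in\mathcal I}\sum_{k=1}^{b_i}y_{i,k}\le\mu_L$; $y_{i,k}\le y_{i,k-1}$ for all $i\in\mathcal I$, $k=2,\dots,b_i$; $0\le y_{i,k}\le1$ for all $i\in\mathcal I$, $k=1,\dots,b_i$. LP-based independent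 rounding: given an optimal solution $\boldsymbol y^*$ of this LP, set $q_i=\frac1{\mu_L}\sum_{k=1}^{b_i}y^*_{i,k}$. Each arriving customer is independently assigned to product $i$ with probability $q_i$, with any remaining probability assigned to rejection; a customer directed to a product with no remaining capacity is rejected. *)

theory Defs
  imports "HOL-Probability.Probability"
begin

record allocation_instance =
  num_products :: nat
  capacity :: "nat \<Rightarrow> nat"
  base_reward :: "nat \<Rightarrow> real"
  bonus :: "nat \<Rightarrow> nat \<Rightarrow> real"
  horizon :: nat
  arrival_prob :: "nat \<Rightarrow> real"

abbreviation products :: "allocation_instance \<Rightarrow> nat set" where
  "products I \<equiv> {1..num_products I}"

definition valid_instance :: "allocation_instance \<Rightarrow> bool" where
  "valid_instance I \<longleftrightarrow>
     (\<forall>i\<in>products I. 0 \<le> base_reward I i \<and> bonus I i 0 = 0 \<and>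
        (\<forall>k. 0 \<le> bonus I i k) \<and> mono (bonus I i)) \<and>
     (\<forall>t\<in>{1..horizon I}. 0 \<le> arrival_prob I t \<and> arrival_prob I t \<le> 1)"

definition sale_reward :: "allocation_instance \<Rightarrow> nat \<Rightarrow> nat \<Rightarrow> real" where
  "sale_reward I i k = base_reward I i + bonus I i k"

definition mean_arrivals :: "allocation_instance \<Rightarrow> real" where
  "mean_arrivals I = (\<Sum>t=1..horizon I. arrival_prob I t)"

definition arrivals_pmf :: "allocation_instance \<Rightarrow> (nat \<Rightarrow> bool) pmf" where
  "arrivals_pmf I = Pi_pmf {1..horizon I} False (\<lambda>t. bernoulli_pmf (arrival_prob I t))"


text \<open>
  A decision rule maps the arrivals observed so far (the current period included, so the list
  has length \<open>t\<close> in period \<open>t\<close>) and the decisions of the preceding periods to a product or to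
  rejection (\<open>None\<close>). Requests for a product that does not exist or has no remaining capacity
  are turned into rejections, so capacities are respected by every rule; periods without an
  arrival are recorded as \<open>None\<close>.
\<close>

type_synonym decision_rule = "bool list \<Rightarrow> nat option list \<Rightarrow> nat option"

definition enforce_capacity ::
    "allocation_instance \<Rightarrow> nat option list \<Rightarrow> nat option \<Rightarrow> nat option" where
  "enforce_capacity I ds x =
     (case x of None \<Rightarrow> None
      | Some i \<Rightarrow> if i \<in> products I \<and> count_list ds (Some i) < capacity I i
                  then Some i else None)"

fun decisions ::
    "allocation_instance \<Rightarrow> decision_rule \<Rightarrow> (nat \<Rightarrow> bool) \<Rightarrow> nat \<Rightarrow> nat option list" where
  "decisions I d a 0 = []"
| "decisions I d a (Suc t) =
     (let ds = decisions I d a t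
      in ds @ [if a (Suc t)
               then enforce_capacity I ds (d (map a [1..<Suc (Suc t)]) ds)
               else None])"

definition sales :: "allocation_instance \<Rightarrow> decision_rule \<Rightarrow> (nat \<Rightarrow> bool) \<Rightarrow> nat \<Rightarrow> nat" where
  "sales I d a i = count_list (decisions I d a (horizon I)) (Some i)"

definition revenue :: "allocation_instance \<Rightarrow> decision_rule \<Rightarrow> (nat \<Rightarrow> bool) \<Rightarrow> real" where
  "revenue I d a = (\<Sum>i\<in>products I. \<Sum>k=1..sales I d a i. sale_reward I i k)"

text \<open>
  A randomized algorithm is a family of decision rules indexed by a seed with law \<open>M\<close>; the
  product measure makes the seed independent of the arrivals.
\<close>

definition expected_revenue ::
    "allocation_instance \<Rightarrow> 's measure \<Rightarrow> ('s \<Rightarrow> decision_rule) \<Rightarrow> real" where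
  "expected_revenue I M \<pi> =
     (\<integral>\<omega>. revenue I (\<pi> (snd \<omega>)) (fst \<omega>) \<partial>(measure_pmf (arrivals_pmf I) \<Otimes>\<^sub>M M))"

text \<open>
  Real-valued seeds with an arbitrary law lose no generality: a single uniform seed already
  encodes an independent sequence of uniform variables.
\<close>

definition online_algorithm :: "real measure \<Rightarrow> (real \<Rightarrow> decision_rule) \<Rightarrow> bool" where
  "online_algorithm M \<pi> \<longleftrightarrow>
     prob_space M \<and> sets M = sets borel \<and>
     (\<forall>as ds. (\<lambda>u. \<pi> u as ds) \<in> measurable M (count_space UNIV))"

definition OPT_on :: "allocation_instance \<Rightarrow> real" where
  "OPT_on I = Sup {expected_revenue I M \<pi> | M \<pi>. online_algorithm M \<pi>}"


definition lp_objective :: "allocation_instance \<Rightarrow> (nat \<Rightarrow> nat \<Rightarrow> real) \<Rightarrow> real" where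
  "lp_objective I y = (\<Sum>i\<in>products I. \<Sum>k=1..capacity I i. sale_reward I i k * y i k)"

definition lp_feasible :: "allocation_instance \<Rightarrow> (nat \<Rightarrow> nat \<Rightarrow> real) \<Rightarrow> bool" where
  "lp_feasible I y \<longleftrightarrow>
     (\<Sum>i\<in>products I. \<Sum>k=1..capacity I i. y i k) \<le> mean_arrivals I \<and>
     (\<forall>i\<in>products I. \<forall>k\<in>{2..capacity I i}. y i k \<le> y i (k - 1)) \<and>
     (\<forall>i\<in>products I. \<forall>k\<in>{1..capacity I i}. 0 \<le> y i k \<and> y i k \<le> 1)"

definition lp_optimal :: "allocation_instance \<Rightarrow> (nat \<Rightarrow> nat \<Rightarrow> real) \<Rightarrow> bool" where
  "lp_optimal I y \<longleftrightarrow>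
     lp_feasible I y \<and> (\<forall>z. lp_feasible I z \<longrightarrow> lp_objective I z \<le> lp_objective I y)"


definition rounding_prob ::
    "allocation_instance \<Rightarrow> (nat \<Rightarrow> nat \<Rightarrow> real) \<Rightarrow> nat \<Rightarrow> real" where
  "rounding_prob I y i = (1 / mean_arrivals I) * (\<Sum>k=1..capacity I i. y i k)"

definition rounding_pmf ::
    "allocation_instance \<Rightarrow> (nat \<Rightarrow> nat \<Rightarrow> real) \<Rightarrow> nat option pmf" where
  "rounding_pmf I y = embed_pmf
     (\<lambda>x. case x of
            Some i \<Rightarrow> if i \<in> products I then rounding_prob I y i else 0
          | None \<Rightarrow> 1 - (\<Sum>i\<in>products I. rounding_prob I y i))"

text \<open>The seed holds one independent draw per period, used if a customer arrives in it.\<close>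

definition lp_rounding_seed ::
    "allocation_instance \<Rightarrow> (nat \<Rightarrow> nat \<Rightarrow> real) \<Rightarrow> (nat \<Rightarrow> nat option) pmf" where
  "lp_rounding_seed I y = Pi_pmf {1..horizon I} None (\<lambda>_. rounding_pmf I y)"

definition lp_rounding_rule :: "(nat \<Rightarrow> nat option) \<Rightarrow> decision_rule" where
  "lp_rounding_rule u as ds = u (length as)"

definition lp_rounding_revenue ::
    "allocation_instance \<Rightarrow> (nat \<Rightarrow> nat \<Rightarrow> real) \<Rightarrow> real" where
  "lp_rounding_revenue I y =
     expected_revenue I (measure_pmf (lp_rounding_seed I y)) lp_rounding_rule"


text \<open>
  The definitions above are total; the following facts show that the ones relying on
  \<^const>\<open>embed_pmf\<close>, \<^const>\<open>Sup\<close> and the existence of an optimal solution are meaningful.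
\<close>

lemma pmf_rounding_pmf:
  assumes "valid_instance I" "lp_feasible I y"
  shows "pmf (rounding_pmf I y) x =
     (case x of
        Some i \<Rightarrow> if i \<in> products I then rounding_prob I y i else 0
      | None \<Rightarrow> 1 - (\<Sum>i\<in>products I. rounding_prob I y i))"
proof -
  let ?f = "\<lambda>x. case x of
        Some i \<Rightarrow> if i \<in> products I then rounding_prob I y i else 0
      | None \<Rightarrow> 1 - (\<Sum>i\<in>products I. rounding_prob I y i)"
  have mu: "0 \<le> mean_arrivals I"
    using assms(1) unfolding mean_arrivals_def valid_instance_def by (auto intro: sum_nonneg)
  have q0: "0 \<le> rounding_prob I y i" if "i \<in> products I" for i
    using assms(2) that mu unfolding rounding_prob_def lp_feasible_def
    by (intro mult_nonneg_nonneg sum_nonneg) auto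
  have le: "(\<Sum>i\<in>products I. \<Sum>k=1..capacity I i. y i k) \<le> mean_arrivals I"
    using assms(2) by (simp add: lp_feasible_def)
  have "(\<Sum>i\<in>products I. rounding_prob I y i)
      = (\<Sum>i\<in>products I. \<Sum>k=1..capacity I i. y i k) / mean_arrivals I"
    unfolding rounding_prob_def by (simp add: sum_divide_distrib)
  also have "\<dots> \<le> 1"
    using le mu by (cases "mean_arrivals I = 0") (auto simp: divide_le_eq)
  finally have q1: "(\<Sum>i\<in>products I. rounding_prob I y i) \<le> 1" .
  have nonneg: "0 \<le> ?f x" for x
    using q0 q1 by (auto split: option.splits)
  have fin: "finite (insert None (Some ` products I))" by simp
  have "(\<integral>\<^sup>+x. ennreal (?f x) \<partial>count_space UNIV)
      = (\<integral>\<^sup>+x. ennreal (?f x) \<partial>count_space (insert None (Some ` products I)))"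
    by (rule nn_integral_count_space_eq) (auto split: option.splits if_splits)
  also have "\<dots> = (\<Sum>x\<in>insert None (Some ` products I). ennreal (?f x))"
    by (rule nn_integral_count_space_finite[OF fin])
  also have "\<dots> = ennreal (\<Sum>x\<in>insert None (Some ` products I). ?f x)"
    by (rule sum_ennreal) (rule nonneg)
  also have "(\<Sum>x\<in>insert None (Some ` products I). ?f x) = 1"
    by (simp add: sum.reindex)
  finally have "(\<integral>\<^sup>+x. ennreal (?f x) \<partial>count_space UNIV) = 1" by simp
  then show ?thesis
    unfolding rounding_pmf_def by (intro pmf_embed_pmf nonneg)
qed

lemma count_decisions_le: "count_list (decisions I d a t) (Some i) \<le> capacity I i"
  by (induction t) (auto simp: Let_def enforce_capacity_def split: option.splits)

lemma revenue_bounds: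
  assumes "valid_instance I"
  shows "0 \<le> revenue I d a"
    and "revenue I d a \<le> (\<Sum>i\<in>products I. \<Sum>k=1..capacity I i. sale_reward I i k)"
proof -
  have nn: "0 \<le> sale_reward I i k" if "i \<in> products I" for i k
    using assms that by (auto simp: valid_instance_def sale_reward_def)
  show "0 \<le> revenue I d a"
    unfolding revenue_def by (intro sum_nonneg nn)
  show "revenue I d a \<le> (\<Sum>i\<in>products I. \<Sum>k=1..capacity I i. sale_reward I i k)"
    unfolding revenue_def
  proof (rule sum_mono)
    fix i assume i: "i \<in> products I"
    have "sales I d a i \<le> capacity I i"
      unfolding sales_def by (rule count_decisions_le)
    then show "(\<Sum>k=1..sales I d a i. sale_reward I i k)
        \<le> (\<Sum>k=1..capacity I i. sale_reward I i k)"
      by (intro sum_mono2 nn i) auto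
  qed
qed

lemma OPT_on_bdd_above:
  assumes "valid_instance I"
  shows "bdd_above {expected_revenue I M \<pi> | M \<pi>. online_algorithm M \<pi>}"
proof -
  let ?B = "\<Sum>i\<in>products I. \<Sum>k=1..capacity I i. sale_reward I i k"
  have B: "0 \<le> ?B"
    using revenue_bounds[OF assms] order_trans by blast
  have "expected_revenue I M \<pi> \<le> ?B" if "online_algorithm M \<pi>" for M \<pi>
  proof -
    let ?P = "measure_pmf (arrivals_pmf I) \<Otimes>\<^sub>M M"
    interpret M: prob_space M using that by (simp add: online_algorithm_def)
    interpret P: pair_prob_space "measure_pmf (arrivals_pmf I)" M ..
    show ?thesis
    proof (cases "integrable ?P (\<lambda>\<omega>. revenue I (\<pi> (snd \<omega>)) (fst \<omega>))")
      case True
      then show ?thesis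
        unfolding expected_revenue_def
        by (intro P.integral_le_const AE_I2 revenue_bounds[OF assms])
    next
      case False
      then show ?thesis
        using B by (simp add: expected_revenue_def not_integrable_integral_eq)
    qed
  qed
  then show ?thesis by (intro bdd_aboveI[of _ ?B]) auto
qed

lemma lp_optimal_exists:
  assumes "valid_instance I"
  shows "\<exists>y. lp_optimal I y"
proof -
  define B where "B = (\<lambda>i. PiE UNIV (\<lambda>k::nat. if i \<in> products I \<and> k \<in> {1..capacity I i}
                        then {0..1::real} else {0}))"
  define K where "K = PiE UNIV B"
  have compact_PiE_UNIV: "compact (PiE UNIV X)"
    if "\<And>i. compact (X i)" for X :: "nat \<Rightarrow> 'b::topological_space set"
  proof -
    have "compactin (product_topology (\<lambda>i::nat. euclidean :: 'b topology) UNIV) (PiE UNIV X)"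
      using that by (subst compactin_PiE) auto
    then show ?thesis by (simp add: euclidean_product_topology)
  qed
  have "compact (B i)" for i
    unfolding B_def by (rule compact_PiE_UNIV) auto
  then have K: "compact K" unfolding K_def by (rule compact_PiE_UNIV)
  have cont: "continuous_on UNIV (\<lambda>y::nat \<Rightarrow> nat \<Rightarrow> real. y i k)" for i k
    by (rule continuous_on_product_then_coordinatewise)
       (rule continuous_on_product_coordinates)
  have "{y. lp_feasible I y} =
     {y. (\<Sum>i\<in>products I. \<Sum>k=1..capacity I i. y i k) \<le> mean_arrivals I} \<inter>
     (\<Inter>i\<in>products I. \<Inter>k\<in>{2..capacity I i}. {y. y i k \<le> y i (k - 1)}) \<inter>
     (\<Inter>i\<in>products I. \<Inter>k\<in>{1..capacity I i}. {y. 0 \<le> y i k} \<inter> {y. y i k \<le> 1})"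
    by (auto simp: lp_feasible_def)
  also have "closed \<dots>"
    by (intro closed_Int closed_INT ballI closed_Collect_le continuous_on_sum cont
        continuous_on_const)
  finally have "compact (K \<inter> {y. lp_feasible I y})"
    using K by (rule compact_Int_closed[rotated])
  moreover have "(\<lambda>_ _. 0) \<in> K \<inter> {y. lp_feasible I y}"
    using assms unfolding K_def B_def lp_feasible_def valid_instance_def mean_arrivals_def
    by (auto intro: sum_nonneg)
  moreover have "continuous_on (K \<inter> {y. lp_feasible I y}) (lp_objective I)"
    unfolding lp_objective_def
    by (rule continuous_on_subset[of UNIV])
       (auto intro!: continuous_on_sum continuous_on_mult cont continuous_on_const)
  ultimately obtain y where y: "lp_feasible I y"
    and max: "\<And>z. z \<in> K \<Longrightarrow> lp_feasible I z \<Longrightarrow> lp_objective I z \<le> lp_objective I y"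
    using continuous_attains_sup[of "K \<inter> {y. lp_feasible I y}" "lp_objective I"] by blast
  have "lp_objective I z \<le> lp_objective I y" if z: "lp_feasible I z" for z
  proof -
    define z' where
      "z' = (\<lambda>i k. if i \<in> products I \<and> k \<in> {1..capacity I i} then z i k else 0)"
    have "(\<Sum>i\<in>products I. \<Sum>k=1..capacity I i. z' i k)
        = (\<Sum>i\<in>products I. \<Sum>k=1..capacity I i. z i k)"
      unfolding z'_def by (intro sum.cong) auto
    then have "lp_feasible I z'"
      using z unfolding lp_feasible_def by (auto simp: z'_def)
    moreover have "z' \<in> K"
      using z unfolding lp_feasible_def K_def B_def z'_def by auto
    moreover have "lp_objective I z' = lp_objective I z"
      unfolding lp_objective_def z'_def by (auto intro!: sum.cong)
    ultimately show ?thesis using max by metis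
  qed
  with y show ?thesis unfolding lp_optimal_def by blast
qed

end

theory Submission
  imports Defs
begin

text \<open>
  Every period brings a customer, and there are \<open>N = K\<^sup>2\<close> periods. Product 1 has \<open>K\<close> units of
  reward 2; product 2 has \<open>N\<close> units and pays only for the \<open>N\<close>-th sale, namely \<open>N\<close>. Directing
  everyone to product 2 earns \<open>N\<close>. Averaged over its units, product 2 is worth 1 per customer, so
  every optimal LP solution fills product 1 and leaves product 2 a fraction at most \<open>1 - 1 / K\<close> of
  the customers. Independent rounding then sells out product 2 with probability at most
  \<open>(1 - 1 / K) ^ N \<le> exp (- K) \<le> 1 / K\<close> and earns at most \<open>2 * K + N / K = 3 * K\<close> in expectation.
\<close>

definition gap_instance :: "nat \<Rightarrow> allocation_instance" where
  "gap_instance K =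
     \<lparr>num_products = 2,
      capacity = (\<lambda>i. if i = 1 then K else K\<^sup>2),
      base_reward = (\<lambda>i. if i = 1 then 2 else 0),
      bonus = (\<lambda>i k. if i \<noteq> 1 \<and> K\<^sup>2 \<le> k then real (K\<^sup>2) else 0),
      horizon = K\<^sup>2,
      arrival_prob = (\<lambda>_. 1)\<rparr>"

lemma gap_instance_simps [simp]:
  "num_products (gap_instance K) = 2"
  "capacity (gap_instance K) i = (if i = 1 then K else K\<^sup>2)"
  "horizon (gap_instance K) = K\<^sup>2"
  "arrival_prob (gap_instance K) t = 1"
  "mean_arrivals (gap_instance K) = real (K\<^sup>2)"
  "sale_reward (gap_instance K) i k =
     (if i = 1 then 2 else if K\<^sup>2 \<le> k then real (K\<^sup>2) else 0)"
  by (simp_all add: gap_instance_def mean_arrivals_def sale_reward_def)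

lemma products_gap_instance: "products (gap_instance K) = {1, 2}"
  by auto

text \<open>The bonus jumps at \<open>K\<^sup>2 \<le> k\<close> instead of being nonzero at a single
  point, because \<open>mono\<close> ranges over all naturals, beyond the capacity as well.\<close>

lemma valid_gap_instance: "K > 0 \<Longrightarrow> valid_instance (gap_instance K)"
  by (auto simp: valid_instance_def gap_instance_def mono_def)

lemma length_decisions [simp]: "length (decisions I d a t) = t"
  by (induction t) (simp_all add: Let_def)

text \<open>Each period adds at most one sale, so \<open>t\<close> sales in \<open>t\<close> periods
  leave no period idle, and capacity enforcement never replaces one product by another. This turns a
  sell-out into an event about the seed alone.\<close>

lemma count_decisions_lp_rounding_rule_eq:
  assumes "count_list (decisions I (lp_rounding_rule u) a t) (Some i) = t"
  shows "\<forall>s\<in>{1..t}. u s = Some i"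
  using assms
proof (induction t)
  case (Suc t)
  let ?ds = "decisions I (lp_rounding_rule u) a t"
  define x where "x = (if a (Suc t) then enforce_capacity I ?ds (u (Suc t)) else None)"
  have "decisions I (lp_rounding_rule u) a (Suc t) = ?ds @ [x]"
    by (simp add: x_def Let_def lp_rounding_rule_def del: upt_Suc)
  with Suc.prems have "count_list (?ds @ [x]) (Some i) = Suc t" by (simp only:)
  with count_le_length[of ?ds "Some i"] have *: "count_list ?ds (Some i) = t" "x = Some i"
    by (simp_all split: if_split_asm)
  from \<open>x = Some i\<close> have "u (Suc t) = Some i"
    by (auto simp: x_def enforce_capacity_def split: if_splits option.splits)
  moreover have "{1..Suc t} = insert (Suc t) {1..t}" by auto
  ultimately show ?case using Suc.IH[OF *(1)] by simp
qed simp

lemma decisions_constant_rule: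
  assumes "i \<in> products I" "t \<le> capacity I i" "\<And>s. s \<in> {1..t} \<Longrightarrow> a s"
  shows "decisions I (\<lambda>_ _. Some i) a t = replicate t (Some i)"
  using assms(2,3)
proof (induction t)
  case (Suc t)
  have "count_list (replicate t (Some i)) (Some i) = t"
    by (induction t) auto
  with Suc assms(1) show ?case
    by (simp add: Let_def enforce_capacity_def replicate_append_same)
qed simp

lemma OPT_on_gap_instance_ge:
  assumes "K > 0"
  shows "real (K\<^sup>2) \<le> OPT_on (gap_instance K)"
proof -
  let ?I = "gap_instance K"
  \<comment> \<open>A point mass as seed law makes the algorithm deterministic. Outside the horizon
    \<open>?A\<close> is false, since \<open>Pi_pmf\<close> puts the default \<open>False\<close>
    there.\<close>
  let ?M = "return borel (0::real)" and ?d = "\<lambda>_ _. Some 2 :: nat option"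
  let ?A = "\<lambda>t. t \<in> {1..K\<^sup>2}"
  interpret M: prob_space ?M by (rule prob_space_return) simp
  have alg: "online_algorithm ?M (\<lambda>_. ?d)"
    by (auto simp: online_algorithm_def M.prob_space_axioms)
  have "bernoulli_pmf 1 = return_pmf True"
    by (intro pmf_eqI) (simp split: bool.splits add: indicator_def)
  then have arr: "arrivals_pmf ?I = return_pmf ?A"
    unfolding arrivals_pmf_def by simp
  \<comment> \<open>The constant rule ignores the seed, so only the marginal law of the arrivals
    matters.\<close>
  have "expected_revenue ?I ?M (\<lambda>_. ?d)
      = (\<integral>a. revenue ?I ?d a \<partial>distr (measure_pmf (arrivals_pmf ?I) \<Otimes>\<^sub>M ?M)
            (measure_pmf (arrivals_pmf ?I)) fst)"
    unfolding expected_revenue_def by (subst integral_distr) auto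
  also have "\<dots> = revenue ?I ?d ?A"
    by (simp add: M.distr_pair_fst arr)
  also have "\<dots> \<ge> real (K\<^sup>2)"
  proof -
    have "decisions ?I ?d ?A (K\<^sup>2) = replicate (K\<^sup>2) (Some 2)"
      by (intro decisions_constant_rule) auto
    moreover have "count_list (replicate n x) x = n" for n and x :: "nat option"
      by (induction n) auto
    ultimately have "sales ?I ?d ?A 2 = K\<^sup>2"
      by (simp add: sales_def)
    moreover have "sale_reward ?I 2 (K\<^sup>2) \<le> (\<Sum>k=1..K\<^sup>2. sale_reward ?I 2 k)"
      using assms by (intro member_le_sum) auto
    ultimately show ?thesis
      unfolding revenue_def products_gap_instance by (simp add: sum_nonneg)
  qed
  finally have "real (K\<^sup>2) \<le> expected_revenue ?I ?M (\<lambda>_. ?d)" .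
  also have "\<dots> \<le> OPT_on ?I"
    unfolding OPT_on_def using alg
    by (intro cSup_upper OPT_on_bdd_above valid_gap_instance assms) blast
  finally show ?thesis .
qed

text \<open>Let \<open>S1\<close>, \<open>S2\<close> be the masses on the two products. The
  objective at \<open>y\<close> is at most \<open>2 * S1 + S2\<close>, hence at most
  \<open>S1 + N\<close> with \<open>N\<close> the number of periods. A feasible point of value
  \<open>N + K\<close> forces \<open>S1\<close> to be at least \<open>K\<close>, which leaves at
  most \<open>N - K\<close> for \<open>S2\<close>.\<close>

lemma rounding_prob_gap_instance_le:
  assumes "K > 0" and opt: "lp_optimal (gap_instance K) y"
  shows "rounding_prob (gap_instance K) y 2 \<le> 1 - 1 / real K"
proof -
  let ?I = "gap_instance K"
  let ?N = "K\<^sup>2"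
  define S1 where "S1 = (\<Sum>k=1..K. y 1 k)"
  define S2 where "S2 = (\<Sum>k=1..?N. y 2 k)"
  have le: "S1 + S2 \<le> ?N"
    and anti: "\<And>k. k \<in> {2..?N} \<Longrightarrow> y 2 k \<le> y 2 (k - 1)"
    using opt unfolding lp_optimal_def lp_feasible_def products_gap_instance S1_def S2_def
    by simp_all
  \<comment> \<open>The ordering constraints make the only paying unit of product 2 its smallest
    variable, so it is at most the average.\<close>
  have last_least: "y 2 ?N \<le> y 2 k" if "1 \<le> k" "k \<le> ?N" for k
    using that(2,1)
  proof (induction k rule: inc_induct)
    case (step k)
    then show ?case using anti[of "Suc k"] by fastforce
  qed simp
  have "real ?N * y 2 ?N = (\<Sum>k=1..?N. y 2 ?N)" by simp
  also have "\<dots> \<le> S2"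
    unfolding S2_def by (intro sum_mono last_least) auto
  finally have last: "real ?N * y 2 ?N \<le> S2" .
  have objective: "lp_objective ?I z = 2 * (\<Sum>k=1..K. z 1 k) + real ?N * z 2 ?N" for z
  proof -
    have "(\<Sum>k=1..?N. sale_reward ?I 2 k * z 2 k)
        = (\<Sum>k=1..?N. if k = ?N then real ?N * z 2 k else 0)"
      by (intro sum.cong) auto
    also have "\<dots> = real ?N * z 2 ?N"
      using assms(1) by (subst sum.delta) auto
    finally show ?thesis
      unfolding lp_objective_def products_gap_instance by (simp add: sum_distrib_left)
  qed
  \<comment> \<open>Sell out product 1 and spread the remaining mass \<open>N - K\<close> evenly
    over the \<open>N\<close> units of product 2; the arrival budget is then used exactly.\<close>
  define z :: "nat \<Rightarrow> nat \<Rightarrow> real" where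
    "z = (\<lambda>i k. if i = 1 then 1 else 1 - 1 / real K)"
  have "lp_feasible ?I z"
    using assms(1)
    unfolding lp_feasible_def products_gap_instance
    by (auto simp: z_def field_simps power2_eq_square)
  with opt have "lp_objective ?I z \<le> lp_objective ?I y"
    by (simp add: lp_optimal_def)
  moreover have "lp_objective ?I z = real ?N + real K"
    using assms(1) unfolding objective by (simp add: z_def field_simps power2_eq_square)
  ultimately have "real K \<le> S1"
    using le last unfolding objective S1_def by linarith
  with le have "S2 \<le> real ?N - real K" by linarith
  then have "S2 / real ?N \<le> (real ?N - real K) / real ?N"
    by (rule divide_right_mono) simp
  also have "\<dots> = 1 - 1 / real K"
    using assms(1) by (simp add: field_simps power2_eq_square)
  finally show ?thesis
    by (simp add: rounding_prob_def S2_def)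
qed

text \<open>A pathwise bound: at most \<open>K\<close> sales of product 1 at reward 2, and product 2
  pays only if the seed directs all periods to it.\<close>

lemma revenue_gap_instance_le:
  assumes "K > 0"
  shows "revenue (gap_instance K) (lp_rounding_rule u) a
     \<le> 2 * real K + real (K\<^sup>2) * indicator (Pi {1..K\<^sup>2} (\<lambda>_. {Some 2})) u"
proof -
  let ?I = "gap_instance K" and ?d = "lp_rounding_rule u"
  let ?N = "K\<^sup>2" and ?E = "Pi {1..K\<^sup>2} (\<lambda>_. {Some 2}) :: (nat \<Rightarrow> nat option) set"
  have cap: "sales ?I ?d a 1 \<le> K" "sales ?I ?d a 2 \<le> ?N"
    using count_decisions_le[of ?I ?d a "horizon ?I" 1] count_decisions_le[of ?I ?d a "horizon ?I" 2]
    by (simp_all add: sales_def)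
  have "(\<Sum>k=1..sales ?I ?d a 2. sale_reward ?I 2 k) \<le> real ?N * indicator ?E u"
  proof (cases "sales ?I ?d a 2 = ?N")
    case True
    then have "u \<in> ?E"
      using count_decisions_lp_rounding_rule_eq[of ?I u a ?N 2] by (auto simp: sales_def)
    moreover have "(\<Sum>k=1..?N. sale_reward ?I 2 k) = (\<Sum>k=1..?N. if k = ?N then real ?N else 0)"
      by (intro sum.cong) auto
    ultimately show ?thesis using True by simp
  next
    case False
    then have "(\<Sum>k=1..sales ?I ?d a 2. sale_reward ?I 2 k) = 0"
      using cap by (intro sum.neutral) auto
    then show ?thesis by (simp only:) simp
  qed
  then show ?thesis
    unfolding revenue_def products_gap_instance using cap(1) by simp
qed

lemma lp_rounding_revenue_gap_instance_le:
  assumes "K > 0" and opt: "lp_optimal (gap_instance K) y"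
  shows "lp_rounding_revenue (gap_instance K) y \<le> 3 * real K"
proof -
  let ?I = "gap_instance K"
  let ?P = "measure_pmf (arrivals_pmf ?I)" and ?S = "measure_pmf (lp_rounding_seed ?I y)"
  let ?N = "K\<^sup>2" and ?E = "Pi {1..K\<^sup>2} (\<lambda>_. {Some 2}) :: (nat \<Rightarrow> nat option) set"
  let ?F = "UNIV \<times> ?E :: ((nat \<Rightarrow> bool) \<times> (nat \<Rightarrow> nat option)) set"
  interpret PS: pair_prob_space ?P ?S ..
  have pmf_rounding: "pmf (rounding_pmf ?I y) (Some 2) = rounding_prob ?I y 2"
    using opt valid_gap_instance[OF assms(1)] by (simp add: pmf_rounding_pmf lp_optimal_def)
  have F: "?F \<in> sets (?P \<Otimes>\<^sub>M ?S)" by (intro pair_measureI) auto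
  have "lp_rounding_revenue ?I y
      \<le> (\<integral>\<omega>. 2 * real K + real ?N * indicator ?F \<omega> \<partial>(?P \<Otimes>\<^sub>M ?S))"
    unfolding lp_rounding_revenue_def expected_revenue_def
  \<comment> \<open>This rule asks for integrability and nonnegativity of the upper bound, not for
    integrability of the revenue.\<close>
  proof (rule integral_mono')
    show "integrable (?P \<Otimes>\<^sub>M ?S) (\<lambda>\<omega>. 2 * real K + real ?N * indicator ?F \<omega>)"
      using F by (intro Bochner_Integration.integrable_add integrable_mult_right
          integrable_real_indicator) (auto simp: less_top[symmetric])
  next
    fix \<omega>
    have "indicator ?F \<omega> = (indicator ?E (snd \<omega>) :: real)"
      by (simp add: indicator_def mem_Times_iff)
    then show "revenue ?I (lp_rounding_rule (snd \<omega>)) (fst \<omega>)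
        \<le> 2 * real K + real ?N * indicator ?F \<omega>"
      using revenue_gap_instance_le[OF assms(1)] by (simp only:)
  qed simp
  also have "\<dots> = 2 * real K + real ?N * measure (?P \<Otimes>\<^sub>M ?S) ?F"
    using F by (subst Bochner_Integration.integral_add)
      (auto simp: less_top[symmetric] PS.prob_space simp del: mem_Times_iff)
  also have "measure (?P \<Otimes>\<^sub>M ?S) ?F = measure ?S ?E"
    by (simp add: measure_def measure_pmf.emeasure_pair_measure_Times
        measure_pmf.emeasure_space_1[simplified])
  \<comment> \<open>The draws of the periods are independent, so the probabilities multiply.\<close>
  also have "\<dots> = rounding_prob ?I y 2 ^ ?N"
    unfolding lp_rounding_seed_def
    by (simp add: measure_Pi_pmf_Pi measure_pmf_single pmf_rounding)
  also have "\<dots> \<le> (1 - 1 / real K) ^ ?N"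
  proof (intro power_mono rounding_prob_gap_instance_le assms)
    show "0 \<le> rounding_prob ?I y 2"
      using pmf_nonneg[of "rounding_pmf ?I y" "Some 2"] unfolding pmf_rounding .
  qed
  \<comment> \<open>Apply \<open>1 + x \<le> exp x\<close> at \<open>x = - 1 / K\<close>; with
    \<open>K\<^sup>2\<close> periods the power becomes \<open>exp (- K)\<close>.\<close>
  also have "\<dots> \<le> exp (- 1 / real K) ^ ?N"
    using assms(1) exp_ge_add_one_self[of "- 1 / real K"] by (intro power_mono) auto
  also have "\<dots> = exp (- real K)"
    using assms(1) by (simp add: exp_of_nat_mult[symmetric] power2_eq_square)
  also have "\<dots> \<le> 1 / real K"
    using assms(1) exp_ge_add_one_self[of "real K"]
    by (simp add: exp_minus inverse_eq_divide frac_le del: exp_ge_add_one_self)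
  finally show ?thesis
    using assms(1) by (simp add: mult_left_mono power2_eq_square)
qed

theorem proposition2:
  fixes ystar :: "allocation_instance \<Rightarrow> nat \<Rightarrow> nat \<Rightarrow> real"
  assumes "\<And>I. valid_instance I \<Longrightarrow> lp_optimal I (ystar I)"
  shows "\<not> (\<exists>c>0. \<forall>I. valid_instance I \<longrightarrow>
              lp_rounding_revenue I (ystar I) \<ge> c * OPT_on I)"
proof
  assume "\<exists>c>0. \<forall>I. valid_instance I \<longrightarrow> lp_rounding_revenue I (ystar I) \<ge> c * OPT_on I"
  then obtain c where c: "c > 0"
    and ratio: "\<And>I. valid_instance I \<Longrightarrow> lp_rounding_revenue I (ystar I) \<ge> c * OPT_on I"
    by blast
  \<comment> \<open>The ratio of the two bounds is \<open>3 * K / K\<^sup>2 = 3 / K\<close>, which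
    has to fall below \<open>c\<close>.\<close>
  obtain K where K: "real K > 3 / c" using reals_Archimedean2 by blast
  with c have pos: "K > 0" by (cases K) (auto simp: field_simps)
  note valid = valid_gap_instance[OF pos]
  have "c * real (K\<^sup>2) \<le> c * OPT_on (gap_instance K)"
    using c OPT_on_gap_instance_ge[OF pos] by (intro mult_left_mono) auto
  also have "\<dots> \<le> lp_rounding_revenue (gap_instance K) (ystar (gap_instance K))"
    by (rule ratio[OF valid])
  \<comment> \<open>The bound holds for every LP optimum, hence for whichever one
    \<open>ystar\<close> selects.\<close>
  also have "\<dots> \<le> 3 * real K"
    by (intro lp_rounding_revenue_gap_instance_le pos assms valid)
  finally have "c * real K \<le> 3"
    using pos by (simp add: power2_eq_square flip: mult.assoc)
  with K c show False by (simp add: field_simps)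
qed

end
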